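(* Let $G$ be a finite simple graph on $n$ vertices which contains a cycle, and let $g$ be its girth. Then $Z(G) \le n - g + 2$, and this bound is sharp (for instance, equality holds when $G$ is the cycle $C_n$).
   Context: The girth of $G$ is the length of a shortest cycle in $G$. Zero forcing process: start with an initial set $S$ of colored vertices. A colored vertex $v$ forces an uncolored neighbor $w$ (making $w$ colored) if $w$ is the only uncolored neighbor of $v$; forces are applied repeatedly. $S$ is a zero forcing set if eventually every vertex becomes colored. $Z(G)$ is the minimum size of a zero forcing set. *)

theory Defs
  imports "Graph_Theory.Graph_Theory"
begin

text \<open>
  Finite simple graphs are the symmetric loop-free digraphs \<^locale>\<open>pair_graph\<close>:
  an edge $\{u, v\}$ is represented by the two arcs $(u, v)$ and $(v, u)$.
\<close>

text \<open>
  In a symmetric digraph the closed walk $u, v, u$ along a single edge is a directed cycle of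
  length 2. It is not a cycle of the undirected graph, hence the bound on the length.
\<close>

definition undirected_cycle :: "'a pair_pre_digraph \<Rightarrow> ('a \<times> 'a) awalk \<Rightarrow> bool" where
  "undirected_cycle G p \<longleftrightarrow> pre_digraph.cycle (with_proj G) p \<and> 3 \<le> length p"

text \<open>Meaningful only if \<open>G\<close> contains a cycle.\<close>

definition girth :: "'a pair_pre_digraph \<Rightarrow> nat" where
  "girth G = (LEAST k. \<exists>p. undirected_cycle G p \<and> length p = k)"

definition neighbors :: "'a pair_pre_digraph \<Rightarrow> 'a \<Rightarrow> 'a set" where
  "neighbors G v = {w. (v, w) \<in> parcs G}"

definition forces :: "'a pair_pre_digraph \<Rightarrow> 'a set \<Rightarrow> 'a \<Rightarrow> 'a \<Rightarrow> bool" where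
  "forces G C v w \<longleftrightarrow> v \<in> C \<and> neighbors G v - C = {w}"

inductive forcing_step :: "'a pair_pre_digraph \<Rightarrow> 'a set \<Rightarrow> 'a set \<Rightarrow> bool"
  for G :: "'a pair_pre_digraph" where
  "forces G C v w \<Longrightarrow> forcing_step G C (insert w C)"

text \<open>
  A vertex that can be forced remains forceable by the same neighbor until it is colored, so the
  order of the forces is irrelevant, and the process colors every vertex iff some sequence of
  forces does.
\<close>

definition zero_forcing_set :: "'a pair_pre_digraph \<Rightarrow> 'a set \<Rightarrow> bool" where
  "zero_forcing_set G S \<longleftrightarrow> S \<subseteq> pverts G \<and> (forcing_step G)\<^sup>*\<^sup>* S (pverts G)"

definition zero_forcing_number :: "'a pair_pre_digraph \<Rightarrow> nat" where
  "zero_forcing_number G = (LEAST k. \<exists>S. zero_forcing_set G S \<and> card S = k)"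

text \<open>The cycle $C_n$, for $n \geq 3$.\<close>

definition cycle_graph :: "nat \<Rightarrow> nat pair_pre_digraph" where
  "cycle_graph n =
    \<lparr> pverts = {..<n},
      parcs = {(i, j). i < n \<and> j < n \<and> (j = Suc i mod n \<or> i = Suc j mod n)} \<rparr>"

end

theory Submission
  imports Defs
begin

text \<open>
  Leave uncolored all but two consecutive vertices of a shortest cycle. Such a cycle has no chord,
  so the colored vertices on it form a path whose last vertex always has exactly one uncolored
  neighbor, namely the next vertex of the cycle; hence the forces run around the cycle.

  For \<open>C\<^sub>n\<close>, a first force by \<open>v\<close> needs \<open>v\<close> and all but one of its neighbors to be colored, so at
  least two vertices are required. A cycle in \<open>C\<^sub>n\<close> is closed under taking neighbors because every
  vertex has degree two, so it visits all vertices and the girth is \<open>n\<close>.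
\<close>

text \<open>Cycles are handled as injective labelings of their vertices by residues modulo the length.\<close>

definition cycle_labeling :: "'a pair_pre_digraph \<Rightarrow> nat \<Rightarrow> (nat \<Rightarrow> 'a) \<Rightarrow> bool" where
  "cycle_labeling G k f \<longleftrightarrow>
     3 \<le> k \<and> inj_on f {..<k} \<and> (\<forall>i<k. (f i, f (Suc i mod k)) \<in> parcs G)"

text \<open>Replaces the recursion of \<open>pcas\<close> by conditions on positions, so that
  consecutive arcs can be compared by index modulo the length.\<close>

lemma pcas_iff_nth:
  assumes "p \<noteq> []"
  shows "pcas u p v \<longleftrightarrow> fst (p ! 0) = u \<and> snd (last p) = v \<and>
           (\<forall>i. Suc i < length p \<longrightarrow> snd (p ! i) = fst (p ! Suc i))"
  using assms
proof (induction p arbitrary: u)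
  case Nil
  then show ?case by simp
next
  case (Cons e p)
  show ?case
  proof (cases "p = []")
    case True
    then show ?thesis by simp
  next
    case False
    have "(\<forall>i. Suc i < length (e # p) \<longrightarrow> snd ((e # p) ! i) = fst ((e # p) ! Suc i)) \<longleftrightarrow>
      snd e = fst (p ! 0) \<and> (\<forall>i. Suc i < length p \<longrightarrow> snd (p ! i) = fst (p ! Suc i))"
      (is "(\<forall>i. ?P i) \<longleftrightarrow> ?R")
    proof
      assume *: "\<forall>i. ?P i"
      from spec[OF *, of 0] False have "snd e = fst (p ! 0)" by simp
      moreover have "snd (p ! i) = fst (p ! Suc i)" if "Suc i < length p" for i
        using spec[OF *, of "Suc i"] that by simp
      ultimately show ?R by blast
    next
      assume ?R
      then show "\<forall>i. ?P i" by (auto simp: nth_Cons split: nat.split)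
    qed
    then show ?thesis using Cons.IH[OF False, of "snd e"] False by auto
  qed
qed

text \<open>The distinctness required by \<open>cycle\<close> concerns this tail; expressed through
  arc heads it becomes injectivity of a labeling.\<close>

lemma tl_pawalk_verts: "pcas u p v \<Longrightarrow> tl (pawalk_verts u p) = map snd p"
proof (induction p arbitrary: u)
  case (Cons e p)
  then show ?case by (cases p) auto
qed simp

text \<open>The length \<open>k\<close> is kept fixed, so the equivalence can be rewritten under the
  \<open>LEAST\<close> in \<open>girth\<close>. A cycle is labeled by the heads of its arcs.\<close>

lemma (in pair_wf_digraph) undirected_cycle_iff_labeling:
  "(\<exists>p. undirected_cycle G p \<and> length p = k) \<longleftrightarrow> (\<exists>f. cycle_labeling G k f)"
proof
  assume "\<exists>p. undirected_cycle G p \<and> length p = k"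
  then obtain p u where k: "3 \<le> k" "length p = k" and arcs: "set p \<subseteq> parcs G"
    and cas: "pcas u p u" and dist: "distinct (tl (pawalk_verts u p))" and ne: "p \<noteq> []"
    by (auto simp: undirected_cycle_def cycle_def awalk_def)
  \<comment> \<open>For the last arc the index wraps to 0, and the equation is the closedness of the
    walk.\<close>
  have step: "snd (p ! i) = fst (p ! (Suc i mod k))" if "i < k" for i
  proof (cases "Suc i < k")
    case True
    then show ?thesis using cas k by (simp add: pcas_iff_nth[OF ne])
  next
    case False
    then have "k = Suc i" using that by simp
    then show ?thesis using cas k ne by (simp add: pcas_iff_nth[OF ne] last_conv_nth)
  qed
  have "(snd (p ! i), snd (p ! (Suc i mod k))) \<in> parcs G" if "i < k" for i
  proof -
    have "Suc i mod k < length p" using k by simp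
    then have "p ! (Suc i mod k) \<in> parcs G" using arcs nth_mem by blast
    then show ?thesis using step[OF that] by simp
  qed
  moreover have "inj_on (\<lambda>i. snd (p ! i)) {..<k}"
    using dist k tl_pawalk_verts[OF cas] by (auto simp: inj_on_def distinct_conv_nth)
  ultimately have "cycle_labeling G k (\<lambda>i. snd (p ! i))"
    using k by (simp add: cycle_labeling_def)
  then show "\<exists>f. cycle_labeling G k f" by blast
next
  assume "\<exists>f. cycle_labeling G k f"
  then obtain f where k: "3 \<le> k" and inj: "inj_on f {..<k}"
    and arc: "\<And>i. i < k \<Longrightarrow> (f i, f (Suc i mod k)) \<in> parcs G"
    by (auto simp: cycle_labeling_def)
  \<comment> \<open>Arc \<open>i\<close> ends, rather than starts, in \<open>f i\<close>, so the
    heads are exactly the labels in order; the walk therefore begins and ends at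
    \<open>f (k - 1)\<close>.\<close>
  define p where "p = map (\<lambda>i. (f (if i = 0 then k - 1 else i - 1), f i)) [0..<k]"
  have len: "length p = k" and ne: "p \<noteq> []" using k by (auto simp: p_def)
  have "(f (if i = 0 then k - 1 else i - 1), f i) \<in> parcs G" if "i < k" for i
    using that arc[of "k - 1"] arc[of "i - 1"] k by (cases i) auto
  then have arcs: "set p \<subseteq> parcs G" by (auto simp: p_def)
  have cas: "pcas (f (k - 1)) p (f (k - 1))"
    unfolding pcas_iff_nth[OF ne] using k by (auto simp: p_def last_conv_nth)
  have "distinct (map snd p)"
    using inj by (simp add: p_def comp_def distinct_map atLeast0LessThan)
  moreover have "f (k - 1) \<in> pverts G" using arc[of "k - 1"] k in_arcsD1 by simp
  ultimately have "undirected_cycle G p"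
    using k len ne arcs cas tl_pawalk_verts[OF cas]
    unfolding undirected_cycle_def cycle_def awalk_def by auto
  then show "\<exists>p. undirected_cycle G p \<and> length p = k" using len by blast
qed

lemma (in pair_wf_digraph) cycle_labeling_in_verts:
  "cycle_labeling G k f \<Longrightarrow> i < k \<Longrightarrow> f i \<in> pverts G"
  using in_arcsD1 unfolding cycle_labeling_def by blast

lemma (in pair_wf_digraph) girth_le: "cycle_labeling G k f \<Longrightarrow> girth G \<le> k"
  unfolding girth_def undirected_cycle_iff_labeling by (rule Least_le) blast

lemma (in pair_wf_digraph) girth_labelingE:
  assumes "undirected_cycle G p"
  obtains f where "cycle_labeling G (girth G) f"
proof -
  have "\<exists>f. cycle_labeling G (length p) f"
    using assms undirected_cycle_iff_labeling by blast
  then show ?thesis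
    using that LeastI[of "\<lambda>k. \<exists>f. cycle_labeling G k f"]
    unfolding girth_def undirected_cycle_iff_labeling by blast
qed

section \<open>Upper bound: forcing along a shortest cycle\<close>

text \<open>The arc closes the segment \<open>f i, ..., f j\<close> to a cycle;
  \<open>Suc i < j\<close> gives it at least three vertices.\<close>

lemma (in pair_graph) chord_imp_cycle_labeling:
  assumes f: "cycle_labeling G k f" and ij: "Suc i < j" "j < k"
    and chord: "(f i, f j) \<in> parcs G"
  shows "cycle_labeling G (Suc (j - i)) (\<lambda>l. f (i + l))"
proof -
  have "(f (i + l), f (i + Suc l mod Suc (j - i))) \<in> parcs G" if "l < Suc (j - i)" for l
  proof (cases "l = j - i")
    case True
    \<comment> \<open>The closing arc is the chord reversed.\<close>
    have "(f j, f i) \<in> parcs G"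
      using chord pair_sym_arcs by (auto simp: symmetric_def sym_def)
    with True ij show ?thesis by simp
  next
    case False
    then have "Suc l mod Suc (j - i) = Suc l" "Suc (i + l) < k" using that ij by auto
    then show ?thesis using f unfolding cycle_labeling_def
      by (metis Suc_lessD add_Suc_right mod_less)
  qed
  moreover have "inj_on (\<lambda>l. f (i + l)) {..<Suc (j - i)}"
  proof (rule inj_onI)
    fix x y assume "x \<in> {..<Suc (j - i)}" "y \<in> {..<Suc (j - i)}" "f (i + x) = f (i + y)"
    moreover from this have "i + x < k" "i + y < k" using ij by auto
    ultimately show "x = y"
      using f inj_onD[of f "{..<k}" "i + x" "i + y"] by (simp add: cycle_labeling_def)
  qed
  ultimately show ?thesis using ij by (simp add: cycle_labeling_def)
qed

text \<open>A second uncolored neighbor \<open>f j\<close> with \<open>j > m\<close> would close a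
  cycle of length \<open>j - m + 2\<close>. Since \<open>j < girth G\<close> and
  \<open>2 \<le> m\<close>, this is less than the girth.\<close>

lemma (in pair_graph) shortest_cycle_forces:
  assumes f: "cycle_labeling G (girth G) f" and m: "2 \<le> m" "m < girth G"
  shows "forces G (pverts G - f ` {m..<girth G}) (f (m - 1)) (f m)"
proof -
  have inj: "inj_on f {..<girth G}"
    and arc: "\<And>i. i < girth G \<Longrightarrow> (f i, f (Suc i mod girth G)) \<in> parcs G"
    using f by (auto simp: cycle_labeling_def)
  have fm: "(f (m - 1), f m) \<in> parcs G" using arc[of "m - 1"] m by simp
  have "f (m - 1) \<notin> f ` {m..<girth G}"
    using inj m by (subst inj_on_image_mem_iff[of f "{..<girth G}"]) auto
  moreover have "j = m" if j: "m \<le> j" "j < girth G" "(f (m - 1), f j) \<in> parcs G" for j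
  proof (rule ccontr)
    assume "j \<noteq> m"
    then have "cycle_labeling G (Suc (j - (m - 1))) (\<lambda>l. f (m - 1 + l))"
      using chord_imp_cycle_labeling[OF f, of "m - 1" j] j m by simp
    then have "girth G \<le> Suc (j - (m - 1))" by (rule girth_le)
    then show False using j m by simp
  qed
  ultimately have "neighbors G (f (m - 1)) - (pverts G - f ` {m..<girth G}) = {f m}"
    using fm m in_arcsD2 unfolding neighbors_def by auto blast
  with \<open>f (m - 1) \<notin> f ` {m..<girth G}\<close> show ?thesis
    using in_arcsD1[OF fm] by (simp add: forces_def)
qed

lemma (in pair_graph) shortest_cycle_zero_forcing_set:
  assumes f: "cycle_labeling G (girth G) f"
  shows "zero_forcing_set G (pverts G - f ` {2..<girth G})"
proof -
  \<comment> \<open>Invariant: once \<open>f 2, ..., f (m - 1)\<close> have been forced, exactly the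
    labels from \<open>m\<close> on are uncolored; at \<open>m = girth G\<close> none are
    left.\<close>
  have "(forcing_step G)\<^sup>*\<^sup>* (pverts G - f ` {2..<girth G}) (pverts G - f ` {m..<girth G})"
    if "2 \<le> m" "m \<le> girth G" for m
    using that
  proof (induction m rule: dec_induct)
    case base
    show ?case by simp
  next
    case (step m)
    let ?C = "pverts G - f ` {m..<girth G}"
    have "forcing_step G ?C (insert (f m) ?C)"
      using shortest_cycle_forces[OF f, of m] step by (intro forcing_step.intros) auto
    moreover have "insert (f m) ?C = pverts G - f ` {Suc m..<girth G}"
    proof -
      have "f m \<in> pverts G"
        using cycle_labeling_in_verts[OF f, of m] step by simp
      moreover have "f m \<notin> f ` {Suc m..<girth G}"
        using f step by (subst inj_on_image_mem_iff[of f "{..<girth G}"])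
          (auto simp: cycle_labeling_def)
      moreover have "{m..<girth G} = insert m {Suc m..<girth G}" using step by auto
      then have "f ` {m..<girth G} = insert (f m) (f ` {Suc m..<girth G})" by simp
      ultimately show ?thesis by auto
    qed
    ultimately have "forcing_step G ?C (pverts G - f ` {Suc m..<girth G})" by simp
    then show ?case using step by simp
  qed
  from this[of "girth G"] f show ?thesis
    by (auto simp: zero_forcing_set_def cycle_labeling_def)
qed

lemma zero_forcing_number_le: "zero_forcing_set G S \<Longrightarrow> zero_forcing_number G \<le> card S"
  unfolding zero_forcing_number_def by (rule Least_le) blast

lemma zero_forcing_number_attained:
  obtains S where "zero_forcing_set G S" "card S = zero_forcing_number G"
proof -
  have "zero_forcing_set G (pverts G)" by (simp add: zero_forcing_set_def)
  then have "\<exists>S. zero_forcing_set G S \<and> card S = zero_forcing_number G"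
    unfolding zero_forcing_number_def
    by (intro LeastI[of "\<lambda>k. \<exists>S. zero_forcing_set G S \<and> card S = k"]) blast
  then show ?thesis using that by blast
qed

lemma (in pair_graph) zero_forcing_number_le_girth:
  assumes "undirected_cycle G p"
  shows "int (zero_forcing_number G) \<le> int (card (pverts G)) - int (girth G) + 2"
proof -
  obtain f where f: "cycle_labeling G (girth G) f" using girth_labelingE[OF assms] .
  have sub: "f ` {2..<girth G} \<subseteq> pverts G"
    using cycle_labeling_in_verts[OF f] by auto
  have "inj_on f {2..<girth G}"
    using f by (auto simp: cycle_labeling_def inj_on_def)
  then have card: "card (f ` {2..<girth G}) = girth G - 2" by (simp add: card_image)
  have "zero_forcing_number G \<le> card (pverts G - f ` {2..<girth G})"
    by (intro zero_forcing_number_le shortest_cycle_zero_forcing_set f)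
  also have "\<dots> = card (pverts G) - (girth G - 2)"
    using sub card by (simp add: card_Diff_subset finite_subset[OF _ pair_finite_verts])
  \<comment> \<open>Both natural subtractions are exact: a labeling has length at least 3, and the
    removed vertices lie in \<open>pverts G\<close>.\<close>
  finally show ?thesis
    using card card_mono[OF pair_finite_verts sub] f by (simp add: cycle_labeling_def)
qed

section \<open>Lower bound by the minimum degree\<close>

text \<open>Look at the first force. If there is none, \<open>S\<close> is the whole vertex set,
  which the bound \<open>d \<le> card (pverts G)\<close> covers.\<close>

lemma (in pair_graph) min_degree_le_zero_forcing_number:
  assumes deg: "\<And>v. v \<in> pverts G \<Longrightarrow> d \<le> card (neighbors G v)" and "d \<le> card (pverts G)"
  shows "d \<le> zero_forcing_number G"
proof -
  obtain S where S: "zero_forcing_set G S" "card S = zero_forcing_number G"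
    using zero_forcing_number_attained .
  then have sub: "S \<subseteq> pverts G" and steps: "(forcing_step G)\<^sup>*\<^sup>* S (pverts G)"
    by (auto simp: zero_forcing_set_def)
  have "d \<le> card S"
  proof (cases "S = pverts G")
    case True
    then show ?thesis using assms by simp
  next
    case False
    then obtain T where "forcing_step G S T" using steps by (meson converse_rtranclpE)
    then obtain v w where vw: "v \<in> S" "neighbors G v - S = {w}"
      by (auto simp: forcing_step.simps forces_def)
    have "v \<notin> neighbors G v" using pair_no_loops by (force simp: neighbors_def)
    have fin: "finite S" using sub pair_finite_verts by (rule finite_subset)
    \<comment> \<open>The colored vertex \<open>v\<close>, not its own neighbor, compensates for the
      uncolored \<open>w\<close> in the count.\<close>
    have "neighbors G v \<subseteq> insert w (S - {v})"
      using vw \<open>v \<notin> neighbors G v\<close> by blast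
    then have "card (neighbors G v) \<le> card (insert w (S - {v}))"
      using fin by (intro card_mono) auto
    also have "\<dots> \<le> Suc (card (S - {v}))" using fin by (simp add: card_insert_if)
    also have "\<dots> = card S" using fin vw by (simp add: card_Suc_Diff1 del: card_Diff_insert)
    finally show ?thesis using deg[of v] vw sub by auto
  qed
  then show ?thesis using S by simp
qed

section \<open>Cycle graphs: degrees and girth\<close>

text \<open>Gives loop-freeness of \<open>cycle_graph n\<close> and, both for its vertices and for
  the indices of a labeling, that predecessor and successor differ.\<close>

lemma Suc_mod_mod_ne:
  assumes "3 \<le> n" "i < n"
  shows "Suc i mod n \<noteq> i" "Suc (Suc i mod n) mod n \<noteq> i"
proof -
  consider "Suc (Suc i) < n" | "Suc (Suc i) = n" | "Suc i = n" using assms by linarith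
  then have "Suc i mod n \<noteq> i \<and> Suc (Suc i mod n) mod n \<noteq> i"
    using assms by cases auto
  then show "Suc i mod n \<noteq> i" "Suc (Suc i mod n) mod n \<noteq> i" by auto
qed

lemma Suc_mod_inj:
  assumes "i < n" "j < n" "Suc i mod n = Suc j mod n"
  shows "i = j"
  using assms by (auto simp: mod_Suc split: if_splits)

lemma pair_graph_cycle_graph:
  assumes "3 \<le> n"
  shows "pair_graph (cycle_graph n)"
proof unfold_locales
  show "finite (parcs (cycle_graph n))"
    by (rule finite_subset[of _ "{..<n} \<times> {..<n}"]) (auto simp: cycle_graph_def)
  show "symmetric (with_proj (cycle_graph n))"
    by (auto simp: symmetric_def sym_def cycle_graph_def)
  show "fst e \<noteq> snd e" if "e \<in> parcs (cycle_graph n)" for e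
    using that Suc_mod_mod_ne(1)[OF assms, of "fst e"] by (auto simp: cycle_graph_def)
qed (auto simp: cycle_graph_def)

lemma cycle_labeling_cycle_graph: "3 \<le> n \<Longrightarrow> cycle_labeling (cycle_graph n) n id"
  by (auto simp: cycle_labeling_def cycle_graph_def)

lemma neighbors_cycle_graph_at_least_two:
  assumes "3 \<le> n" "v < n"
  shows "2 \<le> card (neighbors (cycle_graph n) v)"
proof -
  define u where "u = (if v = 0 then n - 1 else v - 1)"
  have u: "u < n" "Suc u mod n = v" using assms by (auto simp: u_def)
  then have "u \<noteq> Suc v mod n" using Suc_mod_mod_ne(2)[OF assms(1) u(1)] by auto
  moreover have "{u, Suc v mod n} \<subseteq> neighbors (cycle_graph n) v"
    using assms u by (auto simp: neighbors_def cycle_graph_def)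
  moreover have "finite (neighbors (cycle_graph n) v)"
    by (rule finite_subset[of _ "{..<n}"]) (auto simp: neighbors_def cycle_graph_def)
  ultimately show ?thesis
    using card_mono[of "neighbors (cycle_graph n) v" "{u, Suc v mod n}"] by simp
qed

text \<open>If neither \<open>a\<close> nor \<open>b\<close> were the successor of \<open>v\<close>,
  then \<open>v\<close> would be the successor of both, forcing \<open>a = b\<close>.\<close>

lemma neighbors_cycle_graph_at_most_two:
  assumes "v < n"
    and "(v, a) \<in> parcs (cycle_graph n)" "(v, b) \<in> parcs (cycle_graph n)" "a \<noteq> b"
  shows "Suc v mod n \<in> {a, b}"
  using assms Suc_mod_inj[of a n b] by (auto simp: cycle_graph_def)

text \<open>The image of \<open>f\<close> is closed under the successor modulo \<open>n\<close>,
  hence contains every vertex, and \<open>k\<close> labels cover at most \<open>k\<close>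
  vertices.\<close>

lemma cycle_labeling_cycle_graph_length:
  assumes "cycle_labeling (cycle_graph n) k f"
  shows "n \<le> k"
proof -
  have k: "3 \<le> k" and inj: "inj_on f {..<k}"
    and arc: "\<And>i. i < k \<Longrightarrow> (f i, f (Suc i mod k)) \<in> parcs (cycle_graph n)"
    using assms by (auto simp: cycle_labeling_def)
  have lt: "f i < n" if "i < k" for i using arc[OF that] by (simp add: cycle_graph_def)
  have closed: "Suc v mod n \<in> f ` {..<k}" if "v \<in> f ` {..<k}" for v
  proof -
    obtain i where i: "i < k" "v = f i" using \<open>v \<in> f ` {..<k}\<close> by auto
    \<comment> \<open>\<open>h\<close> is the cyclic predecessor of \<open>i\<close>: the vertex
      \<open>f i\<close> has the distinct neighbors \<open>f h\<close> and
      \<open>f (Suc i mod k)\<close> on the cycle, so one of them is its successor in the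
      graph.\<close>
    define h where "h = (if i = 0 then k - 1 else i - 1)"
    have h: "h < k" "Suc h mod k = i" using i by (auto simp: h_def)
    then have "h \<noteq> Suc i mod k" using Suc_mod_mod_ne(2)[OF k h(1)] by auto
    moreover have si: "Suc i mod k < k" using k by simp
    ultimately have "f h \<noteq> f (Suc i mod k)" using inj h by (auto simp: inj_on_def)
    moreover have "(f i, f h) \<in> parcs (cycle_graph n)"
      using arc[OF h(1)] h by (auto simp: cycle_graph_def)
    ultimately have "Suc v mod n \<in> {f h, f (Suc i mod k)}"
      using arc[OF i(1)] lt[OF i(1)] i by (intro neighbors_cycle_graph_at_most_two) auto
    then show ?thesis using h si by auto
  qed
  have reach: "(f 0 + m) mod n \<in> f ` {..<k}" for m
  proof (induction m)
    case 0
    then show ?case using k lt[of 0] by simp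
  next
    case (Suc m)
    then show ?case using closed[OF Suc] by (simp add: mod_Suc_eq)
  qed
  have "{..<n} \<subseteq> f ` {..<k}"
  proof
    fix v assume "v \<in> {..<n}"
    \<comment> \<open>Walking \<open>n - f 0\<close> steps from \<open>f 0\<close> reaches 0, and
      \<open>v\<close> more steps reach \<open>v\<close>.\<close>
    then have "(f 0 + (n - f 0 + v)) mod n = v" using lt[of 0] k by simp
    then show "v \<in> f ` {..<k}" using reach[of "n - f 0 + v"] by simp
  qed
  then have "card {..<n} \<le> card {..<k}" by (intro surj_card_le) auto
  then show ?thesis by simp
qed

lemma girth_cycle_graph:
  assumes "3 \<le> n"
  shows "girth (cycle_graph n) = n"
proof -
  interpret pair_graph "cycle_graph n" using assms by (rule pair_graph_cycle_graph)
  show ?thesis unfolding girth_def undirected_cycle_iff_labeling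
    using cycle_labeling_cycle_graph[OF assms] cycle_labeling_cycle_graph_length
    by (intro Least_equality) blast+
qed

theorem theorem2:
  shows "(\<forall>G :: 'a pair_pre_digraph. pair_graph G \<longrightarrow> (\<exists>p. undirected_cycle G p) \<longrightarrow>
            int (zero_forcing_number G) \<le> int (card (pverts G)) - int (girth G) + 2)
       \<and> (\<forall>n \<ge> 3. pair_graph (cycle_graph n) \<and> (\<exists>p. undirected_cycle (cycle_graph n) p) \<and>
            int (zero_forcing_number (cycle_graph n))
              = int (card (pverts (cycle_graph n))) - int (girth (cycle_graph n)) + 2)"
proof (intro conjI allI impI)
  fix G :: "'a pair_pre_digraph"
  assume "pair_graph G" "\<exists>p. undirected_cycle G p"
  then show "int (zero_forcing_number G) \<le> int (card (pverts G)) - int (girth G) + 2"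
    using pair_graph.zero_forcing_number_le_girth by blast
next
  fix n :: nat assume n: "3 \<le> n"
  show "pair_graph (cycle_graph n)" using n by (rule pair_graph_cycle_graph)
  then interpret pair_graph "cycle_graph n" .
  show ex: "\<exists>p. undirected_cycle (cycle_graph n) p"
    using cycle_labeling_cycle_graph[OF n] undirected_cycle_iff_labeling by blast
  have verts: "pverts (cycle_graph n) = {..<n}" by (simp add: cycle_graph_def)
  have "2 \<le> zero_forcing_number (cycle_graph n)"
    using n neighbors_cycle_graph_at_least_two
    by (intro min_degree_le_zero_forcing_number) (auto simp: verts)
  moreover have "int (zero_forcing_number (cycle_graph n))
      \<le> int (card (pverts (cycle_graph n))) - int (girth (cycle_graph n)) + 2"
    using ex zero_forcing_number_le_girth by blast
  \<comment> \<open>Vertex count and girth are both \<open>n\<close>, so the upper bound evaluates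
    to 2 and meets the lower one.\<close>
  ultimately show "int (zero_forcing_number (cycle_graph n))
      = int (card (pverts (cycle_graph n))) - int (girth (cycle_graph n)) + 2"
    by (simp add: girth_cycle_graph[OF n] verts)
qed

end
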